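(* Let $r\ge 2$ be an integer and let $\{\,,\,\}_r$ be the Poisson bracket on the commutative algebra $\mathcal{A}$ defined in the context. Then $$\{\operatorname{Tr}(L(v))^k,\ \operatorname{Tr}(L(v))^l\}_r=0\qquad\text{for all } k,l\in\{0,1,2,\dots\}.$$
   Context: Let $V=\mathbb{C}^n$ and let $P$ be the flip on $V\otimes V$. Let $L(v)=\|l_i^j(v)\|_{1\le i,j\le n}$ ($i$ labels the row, $j$ the column) be a matrix of functions of a parameter $v$, and let $L^{(k)}(v)=\frac{d^k}{dv^k}L(v)$, $L^{(0)}=L$. Let $\mathcal{A}$ be the commutative algebra of polynomials over $\mathbb{C}$ in the entries of $L^{(k)}(v)$, $k=0,1,2,\dots$, treated as independent generators; all brackets are taken at one and the same value $v$. Write $L_1=L\otimes I$, $L_2=I\otimes L$. For two matrices $A,B$ of the same size with entries in $\mathcal{A}$, $\{A,B\}$ denotes the matrix with entries $\sum_k\{A_i^k,B_k^j\}$. $[\,,\,]$ is the matrix commutator. The Poisson bracket $\{\,,\,\}_r$ on $\mathcal{A}$ is defined on generators by $$\{L_1^{(k)}(v),L_2^{(l)}(v)\}_r=\alpha_r(k,l)\,[L_1^{(k+l+r)}(v),P],\qquad \alpha_r(k,l)=\frac{(k+r-1)!\,(l+r-1)!}{(k+l+2r-1)!\,(r-1)!},\quad k,l\ge 0,$$ and extended to $\mathcal{A}$ by the Leibniz rule. In entries, the bracket of the $(i,j)$ entry of $L^{(k)}$ with the $(p,q)$ entry of $L^{(l)}$ is $\alpha_r(k,l)\left(\delta_p^j\,(L^{(k+l+r)})_i^q-\delta_i^q\,(L^{(k+l+r)})_p^j\right)$.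 $(L(v))^k$ is the usual matrix power and $\operatorname{Tr}$ the usual trace. *)

theory Defs
  imports "HOL-Analysis.Determinants" "HOL-Library.Poly_Mapping"
begin

section \<open>Polynomial algebras and derivations\<close>

text \<open>
  Polynomials over the complex numbers in variables of type 'v: finitely supported maps from
  monomials (finitely supported exponent functions) to coefficients, with the convolution product.
\<close>

type_synonym 'v cpoly = "('v \<Rightarrow>\<^sub>0 nat) \<Rightarrow>\<^sub>0 complex"

definition Const :: "complex \<Rightarrow> 'v cpoly" where
  "Const c = Poly_Mapping.single 0 c"

definition Var :: "'v \<Rightarrow> 'v cpoly" where
  "Var x = Poly_Mapping.single (Poly_Mapping.single x 1) 1"

definition derivation :: "('v cpoly \<Rightarrow> 'v cpoly) \<Rightarrow> bool" where
  "derivation D \<longleftrightarrow>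
     (\<forall>f g. D (f + g) = D f + D g) \<and>
     (\<forall>c f. D (Const c * f) = Const c * D f) \<and>
     (\<forall>f g. D (f * g) = D f * g + f * D g)"

definition biderivation :: "('v cpoly \<Rightarrow> 'v cpoly \<Rightarrow> 'v cpoly) \<Rightarrow> bool" where
  "biderivation B \<longleftrightarrow> (\<forall>g. derivation (\<lambda>f. B f g)) \<and> (\<forall>f. derivation (B f))"


section \<open>The algebra of the entries of the derivatives of L and its bracket\<close>

text \<open>
  The variable \<open>(k, i, j)\<close> stands for the entry in row i, column j of the k-th derivative
  of L at the fixed parameter value; n is the cardinality of the type 'n.
\<close>

type_synonym 'n gen = "nat \<times> 'n \<times> 'n"

definition Lder :: "nat \<Rightarrow> ('n::finite) gen cpoly ^ 'n ^ 'n" where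
  "Lder k = (\<chi> i j. Var (k, i, j))"

text \<open>The subtractions do not truncate for \<open>r \<ge> 1\<close>.\<close>

definition alpha :: "nat \<Rightarrow> nat \<Rightarrow> nat \<Rightarrow> complex" where
  "alpha r k l =
     (fact (k + r - 1) * fact (l + r - 1)) / (fact (k + l + 2 * r - 1) * fact (r - 1))"

definition leibniz_extension ::
  "nat \<Rightarrow> (('n::finite) gen cpoly \<Rightarrow> 'n gen cpoly \<Rightarrow> 'n gen cpoly) \<Rightarrow> bool" where
  "leibniz_extension r B \<longleftrightarrow> biderivation B \<and>
     (\<forall>k i j l p q.
        B (Lder k $ i $ j) (Lder l $ p $ q) =
          Const (alpha r k l) *
            ((if p = j then Lder (k + l + r) $ i $ q else 0) -
             (if i = q then Lder (k + l + r) $ p $ j else 0)))"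

text \<open>
  The description is proper: \<open>leibniz_extension_ex1\<close> below shows that exactly one map satisfies it.
\<close>

definition bracket ::
  "nat \<Rightarrow> ('n::finite) gen cpoly \<Rightarrow> 'n gen cpoly \<Rightarrow> 'n gen cpoly" where
  "bracket r = (THE B. leibniz_extension r B)"

text \<open>
  Matrix powers need their own definition: the type class product on vectors and matrices is the
  componentwise one.
\<close>

primrec matpow :: "'a::semiring_1 ^ 'n ^ 'n \<Rightarrow> nat \<Rightarrow> 'a ^ 'n ^ 'n" where
  "matpow A 0 = mat 1"
| "matpow A (Suc k) = A ** matpow A k"


section \<open>Derivations are determined by arbitrary values on the variables\<close>

lemma sum_single: "(\<Sum>m\<in>Poly_Mapping.keys f. Poly_Mapping.single m (Poly_Mapping.lookup f m)) = f"
  by (rule poly_mapping_eqI)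
     (auto simp: lookup_sum lookup_single when_def in_keys_iff sum.delta)

lemma additive_induct [case_names zero single add]:
  fixes f :: "'a \<Rightarrow>\<^sub>0 'b::comm_monoid_add"
  assumes "P 0" "\<And>m c. P (Poly_Mapping.single m c)" "\<And>f g. P f \<Longrightarrow> P g \<Longrightarrow> P (f + g)"
  shows "P f"
proof -
  have "P (\<Sum>m\<in>A. Poly_Mapping.single m (Poly_Mapping.lookup f m))" if "finite A" for A
    using that by (induction A rule: finite_induct) (auto intro: assms)
  from this[of "Poly_Mapping.keys f"] show ?thesis by (simp add: sum_single)
qed

lemma Const_1: "Const 1 = 1" and Const_0: "Const 0 = 0"
  and Const_add: "Const (c + d) = Const c + Const d"
  and Const_mult: "Const (c * d) = Const c * Const d"
  by (simp_all add: Const_def single_add mult_single)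

lemma derivationD:
  assumes "derivation D"
  shows "D (f + g) = D f + D g" "D (Const c * f) = Const c * D f"
    "D (f * g) = D f * g + f * D g" "D 0 = 0" "D 1 = 0" "D (- f) = - D f" "D (f - g) = D f - D g"
    "D (Const c) = 0"
proof -
  show add: "D (f + g) = D f + D g" for f g using assms by (simp add: derivation_def)
  show scale: "D (Const c * f) = Const c * D f" for c f using assms unfolding derivation_def by blast
  show mult: "D (f * g) = D f * g + f * D g" for f g using assms by (simp add: derivation_def)
  show zero: "D 0 = 0" using add[of 0 0] by simp
  show one: "D 1 = 0" using mult[of 1 1] by simp
  show neg: "D (- f) = - D f" for f using add[of f "- f"] zero by (simp add: eq_neg_iff_add_eq_0 add.commute)
  show "D (f - g) = D f - D g" using add[of f "- g"] neg[of g] by simp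
  show "D (Const c) = 0" using scale[of c 1] one by simp
qed

lemma derivation_unique:
  assumes D: "derivation D" and E: "derivation E" and eq: "\<And>x. D (Var x) = E (Var x)"
  shows "D f = E f"
proof (induction f rule: additive_induct)
  case zero
  show ?case using D E by (simp add: derivationD)
next
  case (add f g)
  then show ?case using D E by (simp add: derivationD)
next
  case (single m c)
  have "D (Poly_Mapping.single m 1) = E (Poly_Mapping.single m 1)"
  proof (induction m rule: additive_induct)
    case zero
    show ?case using D E by (simp add: derivationD)
  next
    case (add a b)
    have "Poly_Mapping.single (a + b) (1::complex) = Poly_Mapping.single a 1 * Poly_Mapping.single b 1"
      by (simp add: mult_single)
    then show ?case using add D E by (simp add: derivationD)
  next
    case (single x k)
    show ?case
    proof (induction k)
      case 0
      show ?case using D E by (simp add: derivationD)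
    next
      case (Suc k)
      have "Poly_Mapping.single (Poly_Mapping.single x (Suc k)) (1::complex) =
            Var x * Poly_Mapping.single (Poly_Mapping.single x k) 1"
        by (simp add: mult_single Var_def flip: single_add)
      then show ?case using Suc eq D E by (simp add: derivationD)
    qed
  qed
  moreover have "Poly_Mapping.single m c = Const c * Poly_Mapping.single m 1"
    by (simp add: Const_def mult_single)
  ultimately show ?case using D E by (simp add: derivationD)
qed

definition dmono :: "('v \<Rightarrow> 'v cpoly) \<Rightarrow> ('v \<Rightarrow>\<^sub>0 nat) \<Rightarrow> 'v cpoly" where
  "dmono \<phi> m = (\<Sum>x\<in>Poly_Mapping.keys m.
     Poly_Mapping.single (m - Poly_Mapping.single x 1) (of_nat (Poly_Mapping.lookup m x)) * \<phi> x)"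

definition dext :: "('v \<Rightarrow> 'v cpoly) \<Rightarrow> 'v cpoly \<Rightarrow> 'v cpoly" where
  "dext \<phi> f = (\<Sum>m\<in>Poly_Mapping.keys f. Const (Poly_Mapping.lookup f m) * dmono \<phi> m)"

lemma dmono_superset:
  assumes "finite A" "Poly_Mapping.keys m \<subseteq> A"
  shows "dmono \<phi> m = (\<Sum>x\<in>A.
     Poly_Mapping.single (m - Poly_Mapping.single x 1) (of_nat (Poly_Mapping.lookup m x)) * \<phi> x)"
  unfolding dmono_def using assms by (intro sum.mono_neutral_left) (auto simp: in_keys_iff)

lemma dext_superset:
  assumes "finite A" "Poly_Mapping.keys f \<subseteq> A"
  shows "dext \<phi> f = (\<Sum>m\<in>A. Const (Poly_Mapping.lookup f m) * dmono \<phi> m)"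
  unfolding dext_def using assms
  by (intro sum.mono_neutral_left) (auto simp: in_keys_iff Const_0)

lemma single_shift:
  "Poly_Mapping.single (a + b - Poly_Mapping.single x 1) (of_nat (Poly_Mapping.lookup a x) :: complex) =
   Poly_Mapping.single (a - Poly_Mapping.single x 1) (of_nat (Poly_Mapping.lookup a x)) * Poly_Mapping.single b 1"
proof (cases "Poly_Mapping.lookup a x = 0")
  case False
  have "a + b - Poly_Mapping.single x 1 = a - Poly_Mapping.single x 1 + b"
    by (rule poly_mapping_eqI)
       (use False in \<open>auto simp: lookup_add lookup_minus lookup_single when_def\<close>)
  then show ?thesis by (simp add: mult_single)
qed simp

lemma dmono_add:
  "dmono \<phi> (a + b) = dmono \<phi> a * Poly_Mapping.single b 1 + Poly_Mapping.single a 1 * dmono \<phi> b"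
proof -
  define A where "A = Poly_Mapping.keys a \<union> Poly_Mapping.keys b"
  have A: "finite A" "Poly_Mapping.keys a \<subseteq> A" "Poly_Mapping.keys b \<subseteq> A" "Poly_Mapping.keys (a + b) \<subseteq> A"
    using keys_add[of a b] by (auto simp: A_def)
  have s: "Poly_Mapping.single (a + b - Poly_Mapping.single x 1) (of_nat (Poly_Mapping.lookup (a + b) x) :: complex) =
      Poly_Mapping.single (a - Poly_Mapping.single x 1) (of_nat (Poly_Mapping.lookup a x)) * Poly_Mapping.single b 1 +
      Poly_Mapping.single a 1 * Poly_Mapping.single (b - Poly_Mapping.single x 1) (of_nat (Poly_Mapping.lookup b x))" for x
    using single_shift[of a b x] single_shift[of b a x]
    by (simp add: lookup_add single_add add.commute[of b a] mult.commute)
  show ?thesis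
    unfolding dmono_superset[OF A(1,2)] dmono_superset[OF A(1,3)] dmono_superset[OF A(1,4)]
      sum_distrib_left sum_distrib_right sum.distrib[symmetric]
    by (intro sum.cong refl, subst s) (simp add: algebra_simps)
qed

lemma dext_add: "dext \<phi> (f + g) = dext \<phi> f + dext \<phi> g"
proof -
  define A where "A = Poly_Mapping.keys f \<union> Poly_Mapping.keys g"
  have A: "finite A" "Poly_Mapping.keys f \<subseteq> A" "Poly_Mapping.keys g \<subseteq> A" "Poly_Mapping.keys (f + g) \<subseteq> A"
    using keys_add[of f g] by (auto simp: A_def)
  show ?thesis
    unfolding dext_superset[OF A(1,2)] dext_superset[OF A(1,3)] dext_superset[OF A(1,4)]
    by (simp add: lookup_add Const_add algebra_simps sum.distrib)
qed

lemma dext_single: "dext \<phi> (Poly_Mapping.single m c) = Const c * dmono \<phi> m"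
  by (subst dext_superset[of "{m}"]) auto

lemma dext_zero: "dext \<phi> 0 = 0"
  by (simp add: dext_def)

lemma derivation_dext: "derivation (dext \<phi>)"
  unfolding derivation_def
proof (intro conjI allI)
  fix f g :: "'a cpoly" and c
  show "dext \<phi> (f + g) = dext \<phi> f + dext \<phi> g" by (rule dext_add)
  show "dext \<phi> (Const c * f) = Const c * dext \<phi> f"
  proof (induction f rule: additive_induct)
    case (single m d)
    show ?case
      by (simp add: dext_single Const_def mult_single flip: mult.assoc)
  qed (simp_all add: dext_zero dext_add algebra_simps)
  show "dext \<phi> (f * g) = dext \<phi> f * g + f * dext \<phi> g"
  proof (induction f rule: additive_induct)
    case (single a c)
    show ?case
    proof (induction g rule: additive_induct)
      case (single b d)
      have "dext \<phi> (Poly_Mapping.single a c * Poly_Mapping.single b d) = Const (c * d) * dmono \<phi> (a + b)"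
        by (simp add: mult_single dext_single)
      also have "\<dots> = Const c * dmono \<phi> a * (Const d * Poly_Mapping.single b 1) +
          Const c * Poly_Mapping.single a 1 * (Const d * dmono \<phi> b)"
        by (simp add: dmono_add Const_mult algebra_simps)
      also have "Const d * Poly_Mapping.single b 1 = Poly_Mapping.single b d"
        by (simp add: Const_def mult_single)
      also have "Const c * Poly_Mapping.single a 1 = Poly_Mapping.single a c"
        by (simp add: Const_def mult_single)
      finally show ?case by (simp only: dext_single)
    qed (simp_all add: dext_zero dext_add algebra_simps)
  qed (simp_all add: dext_zero dext_add algebra_simps)
qed

lemma dext_Var: "dext \<phi> (Var x) = \<phi> x"
  by (simp add: Var_def dext_single dmono_def Const_1)

lemma derivation_mult_left:
  assumes "derivation D"
  shows "derivation (\<lambda>g. a * D g)"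
  unfolding derivation_def
proof (intro conjI allI)
  fix f g c
  show "a * D (f + g) = a * D f + a * D g"
    by (simp add: derivationD(1)[OF assms] distrib_left)
  show "a * D (Const c * f) = Const c * (a * D f)"
    by (simp only: derivationD(2)[OF assms] mult.left_commute)
  show "a * D (f * g) = a * D f * g + f * (a * D g)"
    by (simp only: derivationD(3)[OF assms] distrib_left mult.assoc mult.left_commute)
qed

lemma derivation_sum:
  assumes "\<And>x. derivation (D x)"
  shows "derivation (\<lambda>g. \<Sum>x\<in>A. D x g)"
  unfolding derivation_def
proof (intro conjI allI)
  fix f g c
  show "(\<Sum>x\<in>A. D x (f + g)) = (\<Sum>x\<in>A. D x f) + (\<Sum>x\<in>A. D x g)"
    by (simp only: derivationD(1)[OF assms] sum.distrib)
  show "(\<Sum>x\<in>A. D x (Const c * f)) = Const c * (\<Sum>x\<in>A. D x f)"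
    by (simp only: derivationD(2)[OF assms] sum_distrib_left)
  show "(\<Sum>x\<in>A. D x (f * g)) = (\<Sum>x\<in>A. D x f) * g + f * (\<Sum>x\<in>A. D x g)"
    by (simp only: derivationD(3)[OF assms] sum.distrib sum_distrib_left sum_distrib_right)
qed

lemma derivation_dext_param:
  assumes "\<And>x. derivation (\<lambda>g. \<phi> g x)"
  shows "derivation (\<lambda>g. dext (\<phi> g) f)"
  unfolding dext_def dmono_def
  by (intro derivation_sum derivation_mult_left assms)

lemma biderivation_unique:
  assumes "biderivation B" "biderivation C" "\<And>x y. B (Var x) (Var y) = C (Var x) (Var y)"
  shows "B = C"
proof (intro ext)
  fix f g
  have B: "derivation (B f)" "derivation (\<lambda>f. B f g)" for f g
    using assms(1) by (simp_all add: biderivation_def)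
  have C: "derivation (C f)" "derivation (\<lambda>f. C f g)" for f g
    using assms(2) by (simp_all add: biderivation_def)
  have "B (Var x) g = C (Var x) g" for x
    by (rule derivation_unique[OF B(1) C(1) assms(3)])
  then show "B f g = C f g"
    by (rule derivation_unique[OF B(2) C(2)])
qed

lemma biderivation_exists: "\<exists>B. biderivation B \<and> (\<forall>x y. B (Var x) (Var y) = \<beta> x y)"
proof (intro exI conjI allI)
  let ?B = "\<lambda>f g. dext (\<lambda>x. dext (\<beta> x) g) f"
  show "biderivation ?B"
    by (auto simp: biderivation_def intro!: derivation_dext derivation_dext_param)
  show "?B (Var x) (Var y) = \<beta> x y" for x y by (simp add: dext_Var)
qed

lemma leibniz_extension_ex1:
  "\<exists>!B :: ('n::finite) gen cpoly \<Rightarrow> 'n gen cpoly \<Rightarrow> 'n gen cpoly. leibniz_extension r B"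
proof -
  define \<beta> :: "'n gen \<Rightarrow> 'n gen \<Rightarrow> 'n gen cpoly" where
    "\<beta> = (\<lambda>(k, i, j) (l, p, q). Const (alpha r k l) *
            ((if p = j then Lder (k + l + r) $ i $ q else 0) -
             (if i = q then Lder (k + l + r) $ p $ j else 0)))"
  have iff: "leibniz_extension r B \<longleftrightarrow> biderivation B \<and> (\<forall>x y. B (Var x) (Var y) = \<beta> x y)" for B
    unfolding leibniz_extension_def by (simp add: \<beta>_def Lder_def split_paired_all)
  show ?thesis
    using biderivation_exists[of \<beta>] biderivation_unique unfolding iff by (metis (no_types, lifting))
qed

lemma leibniz_extension_bracket: "leibniz_extension r (bracket r)"
  unfolding bracket_def by (rule theI'[OF leibniz_extension_ex1])


section \<open>The tensor form of the relations, and the Poisson axioms\<close>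

definition tensor_left :: "'a::semiring_1 ^ ('n::finite) ^ 'n \<Rightarrow> 'a ^ ('n \<times> 'n) ^ ('n \<times> 'n)" where
  "tensor_left A = (\<chi> ip jq. if snd ip = snd jq then A $ fst ip $ fst jq else 0)"

definition tensor_right :: "'a::semiring_1 ^ ('n::finite) ^ 'n \<Rightarrow> 'a ^ ('n \<times> 'n) ^ ('n \<times> 'n)" where
  "tensor_right A = (\<chi> ip jq. if fst ip = fst jq then A $ snd ip $ snd jq else 0)"

definition flip_matrix :: "'a::semiring_1 ^ (('n::finite) \<times> 'n) ^ ('n \<times> 'n)" where
  "flip_matrix = (\<chi> ip jq. if fst ip = snd jq \<and> snd ip = fst jq then 1 else 0)"

lemma biderivation_bracket: "biderivation (bracket r)"
  using leibniz_extension_bracket unfolding leibniz_extension_def by (rule conjunct1)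

lemma bracket_Lder:
  "bracket r (Lder k $ i $ j) (Lder l $ p $ q) =
     Const (alpha r k l) *
       ((if p = j then Lder (k + l + r) $ i $ q else 0) -
        (if i = q then Lder (k + l + r) $ p $ j else 0))"
  by (rule leibniz_extension_bracket[unfolded leibniz_extension_def, THEN conjunct2, rule_format])

lemma derivation_bracket: "derivation (\<lambda>f. bracket r f g)" "derivation (bracket r f)"
  by (simp_all add: biderivation_bracket[unfolded biderivation_def])

lemmas bracket_left = derivationD[OF derivation_bracket(1)]
lemmas bracket_right = derivationD[OF derivation_bracket(2)]

lemma bracket_tensor:
  fixes ip jq :: "'n::finite \<times> 'n"
  shows "(\<Sum>ab\<in>UNIV. bracket r (tensor_left (Lder k) $ ip $ ab) (tensor_right (Lder l) $ ab $ jq)) =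
    Const (alpha r k l) *
      (tensor_left (Lder (k + l + r)) ** flip_matrix - flip_matrix ** tensor_left (Lder (k + l + r))) $ ip $ jq"
proof -
  obtain i p where ip: "ip = (i, p)" by fastforce
  obtain j q where jq: "jq = (j, q)" by fastforce
  have "(\<Sum>ab\<in>UNIV. bracket r (tensor_left (Lder k) $ ip $ ab) (tensor_right (Lder l) $ ab $ jq)) =
        (\<Sum>ab\<in>UNIV. if ab = (j, p) then bracket r (Lder k $ i $ j) (Lder l $ p $ q) else 0)"
    by (intro sum.cong refl)
       (auto simp: ip jq tensor_left_def tensor_right_def bracket_left bracket_right split: prod.splits)
  also have "\<dots> = bracket r (Lder k $ i $ j) (Lder l $ p $ q)"
    by simp
  also have "\<dots> = Const (alpha r k l) *
       ((if p = j then Lder (k + l + r) $ i $ q else 0) -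
        (if i = q then Lder (k + l + r) $ p $ j else 0))"
    by (rule bracket_Lder)
  also have "(if p = j then Lder (k + l + r) $ i $ q else 0) =
      (tensor_left (Lder (k + l + r)) ** flip_matrix) $ ip $ jq"
  proof -
    have "(tensor_left (Lder (k + l + r)) ** flip_matrix) $ ip $ jq =
      (\<Sum>ab\<in>UNIV. if ab = (q, j) then (if p = j then Lder (k + l + r) $ i $ q else 0) else 0)"
      unfolding matrix_matrix_mult_def vec_lambda_beta
      by (intro sum.cong refl) (auto simp: ip jq tensor_left_def flip_matrix_def split: prod.splits)
    then show ?thesis by simp
  qed
  also have "(if i = q then Lder (k + l + r) $ p $ j else 0) =
      (flip_matrix ** tensor_left (Lder (k + l + r))) $ ip $ jq"
  proof -
    have "(flip_matrix ** tensor_left (Lder (k + l + r))) $ ip $ jq =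
      (\<Sum>ab\<in>UNIV. if ab = (p, i) then (if i = q then Lder (k + l + r) $ p $ j else 0) else 0)"
      unfolding matrix_matrix_mult_def vec_lambda_beta
      by (intro sum.cong refl) (auto simp: ip jq tensor_left_def flip_matrix_def split: prod.splits)
    then show ?thesis by simp
  qed
  finally show ?thesis by simp
qed

lemma alpha_commute: "alpha r k l = alpha r l k"
  by (simp add: alpha_def ac_simps)

lemma Var_Lder: "Var (k, i, j) = Lder k $ i $ j"
  by (simp add: Lder_def)

lemma bracket_skew:
  fixes f g :: "('n::finite) gen cpoly"
  shows "bracket r f g = - bracket r g f"
proof -
  have "bracket r = (\<lambda>f g :: 'n gen cpoly. - bracket r g f)"
  proof (rule biderivation_unique[OF biderivation_bracket])
    show "biderivation (\<lambda>f g. - bracket r g f)"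
      by (simp add: biderivation_def derivation_def bracket_left bracket_right)
    fix x y :: "'n gen"
    obtain k i j where x: "x = (k, i, j)" by (cases x)
    obtain l p q where y: "y = (l, p, q)" by (cases y)
    show "bracket r (Var x) (Var y) = - bracket r (Var y) (Var x)"
      unfolding x y Var_Lder bracket_Lder alpha_commute[of r l k] add.commute[of l k]
      by (simp add: algebra_simps)
  qed
  then show ?thesis by metis
qed

lemma alpha_cocycle:
  assumes "r \<ge> 1"
  shows "alpha r l m * alpha r k (l + m + r) = alpha r m k * alpha r l (m + k + r)"
proof -
  have 1: "l + m + r + r - 1 = l + m + 2 * r - 1" "m + k + r + r - 1 = m + k + 2 * r - 1"
    "k + (l + m + r) + 2 * r - 1 = k + l + m + 3 * r - 1"
    "l + (m + k + r) + 2 * r - 1 = k + l + m + 3 * r - 1"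
    by simp_all
  show ?thesis unfolding alpha_def 1 by (simp add: field_simps)
qed

lemma bracket_jacobi:
  fixes f g h :: "('n::finite) gen cpoly"
  assumes "r \<ge> 1"
  shows "bracket r f (bracket r g h) + bracket r g (bracket r h f) + bracket r h (bracket r f g) = 0"
proof -
  define J where "J f g h =
      bracket r f (bracket r g h) + bracket r g (bracket r h f) + bracket r h (bracket r f g)"
    for f g h :: "'n gen cpoly"
  have der: "derivation (\<lambda>f. J f g h)" for g h
  proof -
    have eq: "(\<lambda>f. J f g h) = (\<lambda>f. bracket r f (bracket r g h) + bracket r g (bracket r h f)
        - bracket r h (bracket r g f))"
    proof
      fix f
      show "J f g h = bracket r f (bracket r g h) + bracket r g (bracket r h f)
        - bracket r h (bracket r g f)"
        unfolding J_def by (subst bracket_skew[of r f g]) (simp add: bracket_right)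
    qed
    show ?thesis
      unfolding eq derivation_def by (simp add: bracket_left bracket_right algebra_simps)
  qed
  have cyc: "J f g h = J g h f" for f g h by (simp add: J_def algebra_simps)
  have zero: "derivation (\<lambda>f. 0)" by (simp add: derivation_def)
  have gen: "J (Var x) (Var y) (Var z) = 0" for x y z
  proof -
    obtain k i j where x: "x = (k, i, j)" by (cases x)
    obtain l p q where y: "y = (l, p, q)" by (cases y)
    obtain m a b where z: "z = (m, a, b)" by (cases z)
    define c :: "'n gen cpoly" where "c = Const (alpha r l m) * Const (alpha r k (l + m + r))"
    have c2: "Const (alpha r m k) * Const (alpha r l (m + k + r)) = c"
      using alpha_cocycle[OF assms, of l m k] by (simp add: c_def flip: Const_mult)
    have c3: "Const (alpha r k l) * Const (alpha r m (k + l + r)) = c"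
      using alpha_cocycle[OF assms, of m k l] c2 by (simp flip: Const_mult)
    define N :: "'n gen cpoly ^ 'n ^ 'n" where "N = Lder (k + l + m + r + r)"
    have br: "bracket r (Lder k1 $ i1 $ j1) (bracket r (Lder k2 $ i2 $ j2) (Lder k3 $ i3 $ j3)) =
        c * ((if i3 = j2 then (if i2 = j1 then N $ i1 $ j3 else 0) - (if i1 = j3 then N $ i2 $ j1 else 0) else 0)
           - (if i2 = j3 then (if i3 = j1 then N $ i1 $ j2 else 0) - (if i1 = j2 then N $ i3 $ j1 else 0) else 0))"
      if c: "Const (alpha r k2 k3) * Const (alpha r k1 (k2 + k3 + r)) = c"
        and N: "N = Lder (k1 + (k2 + k3 + r) + r)" for k1 k2 k3 i1 i2 i3 j1 j2 j3
      unfolding N c[symmetric] bracket_Lder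
      by (simp add: bracket_right bracket_Lder algebra_simps)
    have N: "N = Lder (k + (l + m + r) + r)" "N = Lder (l + (m + k + r) + r)"
      "N = Lder (m + (k + l + r) + r)"
      by (simp_all add: N_def ac_simps)
    show ?thesis
      unfolding J_def x y z Var_Lder br[OF c_def[symmetric] N(1)] br[OF c2 N(2)] br[OF c3 N(3)]
      by (auto simp: algebra_simps)
  qed
  have 1: "J f (Var y) (Var z) = 0" for f y z
    using derivation_unique[OF der zero gen] .
  have 2: "J f g (Var z) = 0" for f g z
    using derivation_unique[OF der[of "Var z" f] zero, of g] 1 cyc by metis
  have "J f g h = 0" for f g h
    using derivation_unique[OF der[of f g] zero, of h] 2 cyc by metis
  then show ?thesis by (simp add: J_def)
qed

end

theory Submission
  imports Defs
begin

text \<open>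
  Write \<open>A = Lder 0\<close>, \<open>X = Lder r\<close> and \<open>c = alpha r 0 0\<close>. For a derivation D of a commutative
  algebra, the cyclicity of the trace gives the usual rule \<open>D (Tr A^l) = l Tr (A^(l-1) D A)\<close>
  (\<open>derivation_trace_matpow\<close>). Applied to the derivation \<open>{A_i^j, _}\<close> it puts the flow of the
  Hamiltonian \<open>Tr A^l\<close> on the entries of A into Lax form,
  \<open>{A, Tr A^l} = l c [X, A^(l-1)]\<close> (\<open>bracket_trace_matpow\<close>). Applied once more, to the derivation
  \<open>{_, Tr A^l}\<close>, it turns the bracket of the two traces into a multiple of
  \<open>Tr (A^(k-1) [X, A^(l-1)])\<close>. This equals \<open>Tr (X [A^(l-1), A^(k-1)])\<close>, which vanishes since powers
  of A commute.
\<close>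

definition map_entries :: "('a \<Rightarrow> 'b) \<Rightarrow> 'a ^ 'm ^ 'n \<Rightarrow> 'b ^ 'm ^ 'n" where
  "map_entries D A = (\<chi> i j. D (A $ i $ j))"

lemma matpow_commute:
  assumes "A ** B = B ** A"
  shows "matpow A k ** B = B ** matpow A k"
proof (induction k)
  case (Suc k)
  have "matpow A (Suc k) ** B = A ** (matpow A k ** B)"
    by (simp add: matrix_mul_assoc)
  also have "\<dots> = (A ** B) ** matpow A k"
    by (simp add: Suc matrix_mul_assoc)
  also have "\<dots> = B ** matpow A (Suc k)"
    by (simp add: assms matrix_mul_assoc)
  finally show ?case .
qed simp

lemma derivation_sum_apply:
  assumes "derivation D"
  shows "D (\<Sum>x\<in>S. f x) = (\<Sum>x\<in>S. D (f x))"
  by (induction S rule: infinite_finite_induct) (simp_all add: derivationD[OF assms])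

lemma derivation_trace:
  assumes "derivation D"
  shows "D (trace A) = trace (map_entries D A)"
  by (simp add: trace_def map_entries_def derivation_sum_apply[OF assms])

lemma derivation_matrix_mult:
  assumes "derivation D"
  shows "map_entries D (A ** B) = map_entries D A ** B + A ** map_entries D B"
  by (simp add: vec_eq_iff map_entries_def matrix_matrix_mult_def derivation_sum_apply[OF assms]
      derivationD[OF assms] sum.distrib)

lemma derivation_mat_1:
  assumes "derivation D"
  shows "map_entries D (mat 1) = 0"
  by (simp add: vec_eq_iff map_entries_def mat_def derivationD[OF assms])

text \<open>
  The factor B commuting with A is what lets the induction pass: the Leibniz rule leaves
  \<open>Tr ((B A) (D A^k))\<close>, which is the claim for \<open>B A\<close> in place of B.
  For \<open>k = 0\<close> the truncated exponent \<open>k - 1\<close> is harmless, as it comes with the factor 0.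
\<close>

lemma trace_mult_derivation_matpow:
  fixes A B :: "'v cpoly ^ 'n ^ 'n"
  assumes D: "derivation D" and "A ** B = B ** A"
  shows "trace (B ** map_entries D (matpow A k)) =
    of_nat k * trace (B ** matpow A (k - 1) ** map_entries D A)"
  using assms(2)
proof (induction k arbitrary: B)
  case 0
  show ?case by (simp add: derivation_mat_1[OF D] trace_def)
next
  case (Suc k)
  have BA: "A ** (B ** A) = (B ** A) ** A"
    using Suc.prems by (simp add: matrix_mul_assoc)
  have "trace (B ** map_entries D (matpow A (Suc k))) =
      trace ((B ** map_entries D A) ** matpow A k) + trace ((B ** A) ** map_entries D (matpow A k))"
    by (simp add: derivation_matrix_mult[OF D] matrix_add_ldistrib trace_add matrix_mul_assoc)
  also have "trace ((B ** map_entries D A) ** matpow A k) =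
      trace (B ** matpow A k ** map_entries D A)"
    using matpow_commute[OF Suc.prems, of k]
    by (subst trace_mul_sym) (simp add: matrix_mul_assoc)
  also have "trace ((B ** A) ** map_entries D (matpow A k)) =
      of_nat k * trace (B ** matpow A k ** map_entries D A)"
    unfolding Suc.IH[OF BA] by (cases k) (simp_all add: matrix_mul_assoc)
  finally show ?case by (simp add: algebra_simps)
qed

lemma derivation_trace_matpow:
  fixes A :: "'v cpoly ^ 'n ^ 'n"
  assumes "derivation D"
  shows "D (trace (matpow A k)) = of_nat k * trace (matpow A (k - 1) ** map_entries D A)"
  using trace_mult_derivation_matpow[OF assms, of A "mat 1" k]
  by (simp add: derivation_trace[OF assms])

text \<open>
  The gradient of \<open>Tr A^l\<close> in the entry (p, q) is l times the (q, p) entry of \<open>A^(l-1)\<close>; contracting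
  it with the two Kronecker deltas of the bracket of generators yields the two matrix products.
\<close>

lemma bracket_trace_matpow:
  fixes i j :: "'n::finite"
  shows "bracket r (Lder 0 $ i $ j) (trace (matpow (Lder 0) l)) =
    of_nat l * Const (alpha r 0 0) *
      (Lder r ** matpow (Lder 0) (l - 1) - matpow (Lder 0) (l - 1) ** Lder r) $ i $ j"
proof -
  define A X Q :: "'n gen cpoly ^ 'n ^ 'n"
    where "A = Lder 0" and "X = Lder r" and "Q = matpow A (l - 1)"
  define c :: "'n gen cpoly" where "c = Const (alpha r 0 0)"
  have gen: "bracket r (A $ i $ j) (A $ p $ q) =
      c * ((if p = j then X $ i $ q else 0) - (if i = q then X $ p $ j else 0))" for p q
    by (simp add: A_def X_def c_def bracket_Lder)
  have "trace (Q ** map_entries (bracket r (A $ i $ j)) A) =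
      (\<Sum>q\<in>UNIV. \<Sum>p\<in>UNIV.
         c * ((if p = j then Q $ q $ p * X $ i $ q else 0)
            - (if i = q then Q $ q $ p * X $ p $ j else 0)))"
    unfolding trace_def matrix_matrix_mult_def map_entries_def vec_lambda_beta gen
    by (intro sum.cong refl) (simp add: algebra_simps)
  also have "\<dots> = c * ((\<Sum>q\<in>UNIV. \<Sum>p\<in>UNIV. if p = j then Q $ q $ p * X $ i $ q else 0)
      - (\<Sum>p\<in>UNIV. \<Sum>q\<in>UNIV. if i = q then Q $ q $ p * X $ p $ j else 0))"
    unfolding sum_distrib_left[symmetric] sum_subtractf
    by (subst (4) sum.swap) (rule refl)
  also have "\<dots> = c * (X ** Q - Q ** X) $ i $ j"
    by (simp add: matrix_matrix_mult_def mult.commute)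
  finally show ?thesis
    using derivation_trace_matpow[OF derivation_bracket(2), of r "A $ i $ j" A l]
    by (simp add: A_def X_def Q_def c_def mult.assoc)
qed

lemma trace_mult_commutator:
  fixes P X Q :: "'a::comm_ring_1 ^ 'n ^ 'n"
  assumes "P ** Q = Q ** P"
  shows "trace (P ** (X ** Q - Q ** X)) = 0"
proof -
  have "trace (P ** (X ** Q)) = trace (X ** (Q ** P))"
    using trace_mul_sym[of P "X ** Q"] by (simp add: matrix_mul_assoc)
  also have "\<dots> = trace (P ** (Q ** X))"
    using trace_mul_sym[of X "P ** Q"] by (simp add: assms matrix_mul_assoc)
  finally have "trace (P ** (X ** Q)) = trace (P ** (Q ** X))" .
  moreover have "P ** (X ** Q - Q ** X) = P ** (X ** Q) - P ** (Q ** X)"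
    using matrix_add_ldistrib[of P "X ** Q - Q ** X" "Q ** X"] by (simp add: eq_diff_eq)
  ultimately show ?thesis by (simp add: trace_sub)
qed

theorem proposition5:
  fixes r k l :: nat
  assumes "r \<ge> 2"
  shows "bracket r (trace (matpow (Lder 0 :: ('n::finite) gen cpoly ^ 'n ^ 'n) k))
                   (trace (matpow (Lder 0) l)) = 0"
proof -
  define A X P Q :: "'n gen cpoly ^ 'n ^ 'n" where "A = Lder 0" and "X = Lder r"
    and "P = matpow A (k - 1)" and "Q = matpow A (l - 1)"
  define s :: "'n gen cpoly" where "s = of_nat l * Const (alpha r 0 0)"
  have PQ: "P ** Q = Q ** P"
    unfolding P_def Q_def by (intro matpow_commute matpow_commute[symmetric] refl)
  have lax: "bracket r (A $ i $ j) (trace (matpow A l)) = s * (X ** Q - Q ** X) $ i $ j" for i j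
    unfolding A_def X_def Q_def s_def by (rule bracket_trace_matpow)
  have "trace (P ** map_entries (\<lambda>f. bracket r f (trace (matpow A l))) A) =
      s * trace (P ** (X ** Q - Q ** X))"
    unfolding map_entries_def lax
    by (simp add: trace_def matrix_matrix_mult_def[of P] sum_distrib_left mult.left_commute)
  also have "\<dots> = 0"
    by (simp add: trace_mult_commutator[OF PQ])
  finally show ?thesis
    using derivation_trace_matpow[of "\<lambda>f. bracket r f (trace (matpow A l))" A k,
        OF derivation_bracket(1)]
    by (simp add: A_def P_def)
qed

end
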